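(* Let $A=K[a_1,\ldots,a_n]$ be a weighted $\mathbb{N}$-graded solvable polynomial algebra with respect to a positive-degree function $d(\ )$, with admissible system $(\mathscr{B},\prec)$, let $L_0=\oplus_{i=1}^sAe_i$ be an $\mathbb{N}$-graded free left $A$-module with $d_{\rm gr}(e_i)=b_i$, let $N=\sum_{\ell=1}^mA\xi_{\ell}$ be a graded submodule generated by nonzero homogeneous elements $\xi_{\ell}=\sum_{k=1}^sf_{k\ell}e_k$ with $f_{k\ell}\in A$ (so every nonzero $f_{k\ell}$ is homogeneous), and let $M=L_0/N$, where $\overline{e}_k$ denotes the coset of $e_k$ in $M$. Then the algorithm below returns a subset $\{e_{i_1},\ldots,e_{i_{s'}}\}\subset\{e_1,\ldots,e_s\}$ and a subset $V=\{v_1,\ldots,v_t\}\subset N\cap L_0'$ such that $M\cong L_0'/N'$ as graded $A$-modules, where $L_0'=\oplus_{q=1}^{s'}Ae_{i_q}$ with $s'\le s$ and $N'=\sum_{k=1}^tAv_k$, and such that $\{\overline{e}_{i_1},\ldots,\overline{e}_{i_{s'}}\}$ is a minimal homogeneous generating set of $M$. Algorithm. Input: $E=\{e_1,\ldots,e_s\}$ and $U=\{\xi_1,\ldots,\xi_m\}$. Initialize $t:=m$, $V:=U$, $s':=s$, $E':=E$. While there is some $v_j=\sum_{k=1}^{s'}f_{kj}e_k\in V$ and an index $i$ with $f_{kj}\notin K^*$ for $k<i$ and $f_{ij}\in K^*$, do: for all $\ell\in T=\{1,\ldots,j-1,j+1,\ldots,t\}$ compute $v_{\ell}'=v_{\ell}-\frac{1}{f_{ij}}f_{i\ell}v_j$,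 where $f_{i\ell}$ is the $e_i$-coefficient of $v_\ell$; let $r=\#\{\ell\in T\mid v_{\ell}'=0\}$; set $t:=t-r-1$, $V:=\{v_{\ell}'\mid\ell\in T,\ v_{\ell}'\ne0\}$ (re-indexed as $v_1,\ldots,v_t$), $s':=s'-1$, $E':=E'\setminus\{e_i\}$ (re-indexed as $e_1,\ldots,e_{s'}$). Output: $E'=\{e_{i_1},\ldots,e_{i_{s'}}\}$ and $V=\{v_1,\ldots,v_t\}$, with $v_j=\sum_{q=1}^{s'}h_{qj}e_{i_q}$ and $h_{qj}\notin K^*$ whenever $h_{qj}\ne0$, $1\le j\le t$.
   Context: $K$ is a field, $K^*=K\setminus\{0\}$, $\mathbb{N}$ is the set of nonnegative integers; algebras are associative unital $K$-algebras; modules are left unitary modules. Solvable polynomial algebra. $A=K[a_1,\ldots,a_n]$ is a $K$-algebra generated by a minimal generating set $\{a_1,\ldots,a_n\}$ (not necessarily commuting) such that $\mathscr{B}=\{a^{\alpha}=a_1^{\alpha_1}\cdots a_n^{\alpha_n}\mid\alpha\in\mathbb{N}^n\}$ is a $K$-basis of $A$. For a total ordering $\prec$ on $\mathscr{B}$ and $0\ne f\in A$, $\mathbf{LM}(f)$ is the largest element of $\mathscr{B}$ occurring in $f$. $\prec$ is a monomial ordering if: (1) it is a well-ordering; (2) if $a^{\alpha}\prec a^{\beta}$ and $\mathbf{LM}(a^{\gamma}a^{\alpha}a^{\eta}),\mathbf{LM}(a^{\gamma}a^{\beta}a^{\eta})\notin K$ then $\mathbf{LM}(a^{\gamma}a^{\alpha}a^{\eta})\prec\mathbf{LM}(a^{\gamma}a^{\beta}a^{\eta})$;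 (3) if $a^{\beta}\ne a^{\gamma}$ and $a^{\gamma}=\mathbf{LM}(a^{\alpha}a^{\beta}a^{\eta})$ then $a^{\beta}\prec a^{\gamma}$. Then $(\mathscr{B},\prec)$ is an admissible system. $A$ is a solvable polynomial algebra if moreover for all $\alpha,\beta$: $a^{\alpha}a^{\beta}=\lambda_{\alpha,\beta}a^{\alpha+\beta}+f_{\alpha,\beta}$ with $\lambda_{\alpha,\beta}\in K^*$ and $f_{\alpha,\beta}=0$ or $\mathbf{LM}(f_{\alpha,\beta})\prec a^{\alpha+\beta}$. Grading. A positive-degree function $d(\ )$ is given by integers $d(a_i)=m_i>0$, $d(a^{\alpha})=\sum m_i\alpha_i$. Put $A_p=K\text{-span}\{a^{\alpha}\mid d(a^{\alpha})=p\}$ (so $A_0=K$); $A$ is weighted $\mathbb{N}$-graded with respect to $d(\ )$ if $A_pA_q\subseteq A_{p+q}$ for all $p,q$. For a free module $L_0=\oplus_iAe_i$ with arbitrarily chosen $b_i\in\mathbb{N}$, the grading is $L_0=\oplus_qL_{0q}$, $L_{0q}=K\text{-span}\{a^{\alpha}e_i\mid d(a^{\alpha})+b_i=q\}$, so $d_{\rm gr}(e_i)=b_i$, where $d_{\rm gr}$ denotes the degree of a nonzero homogeneous element. A graded submodule is one generated by homogeneous elements. A minimal homogeneous generating set is a generating set of homogeneous elements no proper subset of which generates. *)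

theory Defs
  imports Complex_Main "HOL-Library.Function_Algebras"
begin

section \<open>Solvable polynomial algebras\<close>

locale assoc_algebra = vector_space scale
  for scale :: "'k::field \<Rightarrow> 'a::ring_1 \<Rightarrow> 'a" +
  assumes scale_mult_left: "scale c x * y = scale c (x * y)"
    and scale_mult_right: "x * scale c y = scale c (x * y)"

definition scalars :: "('k::field \<Rightarrow> 'a::ring_1 \<Rightarrow> 'a) \<Rightarrow> 'a set" where
  "scalars scale = range (\<lambda>c. scale c 1)"

text \<open>The image of \<open>K\<^sup>*\<close> in the algebra.\<close>

definition nonzero_scalars :: "('k::field \<Rightarrow> 'a::ring_1 \<Rightarrow> 'a) \<Rightarrow> 'a set" where
  "nonzero_scalars scale = {scale c 1 |c. c \<noteq> 0}"

definition generated_subalgebra :: "('k::field \<Rightarrow> 'a::ring_1 \<Rightarrow> 'a) \<Rightarrow> 'a set \<Rightarrow> 'a set" where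
  "generated_subalgebra scale S =
     \<Inter>{B. S \<subseteq> B \<and> scalars scale \<subseteq> B \<and> (\<forall>x\<in>B. \<forall>y\<in>B. x + y \<in> B \<and> x * y \<in> B)}"

text \<open>The generators are \<open>a 0, \<dots>, a (n - 1)\<close>. An element of \<open>\<nat>\<^sup>n\<close> is a function on \<open>nat\<close>
  vanishing outside \<open>{..<n}\<close>, so that \<open>\<alpha> + \<beta>\<close> is the pointwise sum.\<close>

definition exponents :: "nat \<Rightarrow> (nat \<Rightarrow> nat) set" where
  "exponents n = {\<alpha>. \<forall>i. n \<le> i \<longrightarrow> \<alpha> i = 0}"

definition mono_pow :: "nat \<Rightarrow> (nat \<Rightarrow> 'a::ring_1) \<Rightarrow> (nat \<Rightarrow> nat) \<Rightarrow> 'a" where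
  "mono_pow n a \<alpha> = prod_list (map (\<lambda>i. a i ^ \<alpha> i) [0..<n])"

definition monomials :: "nat \<Rightarrow> (nat \<Rightarrow> 'a::ring_1) \<Rightarrow> 'a set" where
  "monomials n a = mono_pow n a ` exponents n"

definition has_monomial_basis ::
    "('k::field \<Rightarrow> 'a::ring_1 \<Rightarrow> 'a) \<Rightarrow> nat \<Rightarrow> (nat \<Rightarrow> 'a) \<Rightarrow> bool" where
  "has_monomial_basis scale n a \<longleftrightarrow>
     inj_on (mono_pow n a) (exponents n) \<and>
     \<not> module.dependent scale (monomials n a) \<and>
     module.span scale (monomials n a) = UNIV"

text \<open>Only meaningful for \<open>f \<noteq> 0\<close> and \<open>prec\<close> a strict total order on the monomials.\<close>

definition LM ::
    "('k::field \<Rightarrow> 'a::ring_1 \<Rightarrow> 'a) \<Rightarrow> nat \<Rightarrow> (nat \<Rightarrow> 'a) \<Rightarrow> ('a \<Rightarrow> 'a \<Rightarrow> bool) \<Rightarrow> 'a \<Rightarrow> 'a" where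
  "LM scale n a prec f =
     (let supp = {u \<in> monomials n a. module.representation scale (monomials n a) f u \<noteq> 0}
      in THE u. u \<in> supp \<and> (\<forall>v\<in>supp. v \<noteq> u \<longrightarrow> prec v u))"

text \<open>\<open>prec\<close> is strict. Products are required to be nonzero wherever their leading
  monomial is mentioned, since \<open>LM 0\<close> is undefined.\<close>

definition monomial_ordering ::
    "('k::field \<Rightarrow> 'a::ring_1 \<Rightarrow> 'a) \<Rightarrow> nat \<Rightarrow> (nat \<Rightarrow> 'a) \<Rightarrow> ('a \<Rightarrow> 'a \<Rightarrow> bool) \<Rightarrow> bool" where
  "monomial_ordering scale n a prec \<longleftrightarrow>
     irreflp_on (monomials n a) prec \<and> transp_on (monomials n a) prec \<and>
     totalp_on (monomials n a) prec \<and> wfp_on (monomials n a) prec \<and>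
     (\<forall>u\<in>monomials n a. \<forall>v\<in>monomials n a. \<forall>g\<in>monomials n a. \<forall>h\<in>monomials n a.
        prec u v \<and> g * u * h \<noteq> 0 \<and> g * v * h \<noteq> 0 \<and>
        LM scale n a prec (g * u * h) \<notin> scalars scale \<and>
        LM scale n a prec (g * v * h) \<notin> scalars scale
        \<longrightarrow> prec (LM scale n a prec (g * u * h)) (LM scale n a prec (g * v * h))) \<and>
     (\<forall>u\<in>monomials n a. \<forall>v\<in>monomials n a. \<forall>g\<in>monomials n a. \<forall>h\<in>monomials n a.
        u \<noteq> v \<and> g * u * h \<noteq> 0 \<and> v = LM scale n a prec (g * u * h) \<longrightarrow> prec u v)"

definition solvable_polynomial_algebra ::
    "('k::field \<Rightarrow> 'a::ring_1 \<Rightarrow> 'a) \<Rightarrow> nat \<Rightarrow> (nat \<Rightarrow> 'a) \<Rightarrow> ('a \<Rightarrow> 'a \<Rightarrow> bool) \<Rightarrow> bool" where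
  "solvable_polynomial_algebra scale n a prec \<longleftrightarrow>
     assoc_algebra scale \<and>
     generated_subalgebra scale (a ` {..<n}) = UNIV \<and>
     (\<forall>S. S \<subset> a ` {..<n} \<longrightarrow> generated_subalgebra scale S \<noteq> UNIV) \<and>
     has_monomial_basis scale n a \<and>
     monomial_ordering scale n a prec \<and>
     (\<forall>\<alpha>\<in>exponents n. \<forall>\<beta>\<in>exponents n. \<exists>c f. c \<noteq> 0 \<and>
        mono_pow n a \<alpha> * mono_pow n a \<beta> = scale c (mono_pow n a (\<alpha> + \<beta>)) + f \<and>
        (f = 0 \<or> prec (LM scale n a prec f) (mono_pow n a (\<alpha> + \<beta>))))"

definition exp_degree :: "nat \<Rightarrow> (nat \<Rightarrow> nat) \<Rightarrow> (nat \<Rightarrow> nat) \<Rightarrow> nat" where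
  "exp_degree n d \<alpha> = (\<Sum>i<n. d i * \<alpha> i)"

definition algebra_component ::
    "('k::field \<Rightarrow> 'a::ring_1 \<Rightarrow> 'a) \<Rightarrow> nat \<Rightarrow> (nat \<Rightarrow> 'a) \<Rightarrow> (nat \<Rightarrow> nat) \<Rightarrow> nat \<Rightarrow> 'a set" where
  "algebra_component scale n a d p =
     module.span scale {mono_pow n a \<alpha> |\<alpha>. \<alpha> \<in> exponents n \<and> exp_degree n d \<alpha> = p}"

definition weighted_graded ::
    "('k::field \<Rightarrow> 'a::ring_1 \<Rightarrow> 'a) \<Rightarrow> nat \<Rightarrow> (nat \<Rightarrow> 'a) \<Rightarrow> (nat \<Rightarrow> nat) \<Rightarrow> bool" where
  "weighted_graded scale n a d \<longleftrightarrow>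
     (\<forall>i<n. 0 < d i) \<and>
     (\<forall>p q. \<forall>x\<in>algebra_component scale n a d p. \<forall>y\<in>algebra_component scale n a d q.
        x * y \<in> algebra_component scale n a d (p + q))"


section \<open>Graded left modules\<close>

text \<open>The library locale \<open>module\<close> needs a commutative ring of scalars, hence this record for
  graded left modules over a possibly noncommutative ring; \<open>component M q\<close> is the set of
  homogeneous elements of degree \<open>q\<close>, including \<open>0\<close>.\<close>

record ('a, 'm) graded_module =
  carrier :: "'m set"
  add :: "'m \<Rightarrow> 'm \<Rightarrow> 'm"
  zero :: 'm
  smult :: "'a \<Rightarrow> 'm \<Rightarrow> 'm"
  component :: "nat \<Rightarrow> 'm set"

definition homogeneous :: "('a, 'm) graded_module \<Rightarrow> 'm \<Rightarrow> bool" where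
  "homogeneous M x \<longleftrightarrow> (\<exists>q. x \<in> component M q)"

text \<open>Closure under negation follows from closure under multiplication by \<open>-1\<close>.\<close>

definition is_submodule :: "('a, 'm) graded_module \<Rightarrow> 'm set \<Rightarrow> bool" where
  "is_submodule M H \<longleftrightarrow>
     H \<subseteq> carrier M \<and> zero M \<in> H \<and>
     (\<forall>x\<in>H. \<forall>y\<in>H. add M x y \<in> H) \<and> (\<forall>r. \<forall>x\<in>H. smult M r x \<in> H)"

definition generated_submodule :: "('a, 'm) graded_module \<Rightarrow> 'm set \<Rightarrow> 'm set" where
  "generated_submodule M S = \<Inter>{H. is_submodule M H \<and> S \<subseteq> H}"

definition graded_submodule :: "('a, 'm) graded_module \<Rightarrow> 'm set \<Rightarrow> bool" where
  "graded_submodule M H \<longleftrightarrow>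
     (\<exists>S \<subseteq> carrier M. (\<forall>x\<in>S. homogeneous M x) \<and> H = generated_submodule M S)"

definition minimal_homogeneous_generating_set :: "('a, 'm) graded_module \<Rightarrow> 'm set \<Rightarrow> bool" where
  "minimal_homogeneous_generating_set M G \<longleftrightarrow>
     G \<subseteq> carrier M \<and> (\<forall>x\<in>G. homogeneous M x) \<and> generated_submodule M G = carrier M \<and>
     (\<forall>G'. G' \<subset> G \<longrightarrow> generated_submodule M G' \<noteq> carrier M)"

definition coset :: "('a, 'm) graded_module \<Rightarrow> 'm set \<Rightarrow> 'm \<Rightarrow> 'm set" where
  "coset M H x = add M x ` H"

text \<open>In the scalar multiple \<open>H\<close> is added back because \<open>r X\<close> alone need not be a full coset.\<close>

definition quotient_module ::
    "('a, 'm) graded_module \<Rightarrow> 'm set \<Rightarrow> ('a, 'm set) graded_module" where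
  "quotient_module M H =
     \<lparr>carrier = coset M H ` carrier M,
      add = (\<lambda>X Y. {add M x y |x y. x \<in> X \<and> y \<in> Y}),
      zero = H,
      smult = (\<lambda>r X. {add M (smult M r x) h |x h. x \<in> X \<and> h \<in> H}),
      component = (\<lambda>q. coset M H ` component M q)\<rparr>"

definition graded_isomorphic ::
    "('a, 'm) graded_module \<Rightarrow> ('a, 'l) graded_module \<Rightarrow> bool" where
  "graded_isomorphic M L \<longleftrightarrow>
     (\<exists>\<phi>. bij_betw \<phi> (carrier M) (carrier L) \<and>
        (\<forall>x\<in>carrier M. \<forall>y\<in>carrier M. \<phi> (add M x y) = add L (\<phi> x) (\<phi> y)) \<and>
        (\<forall>r. \<forall>x\<in>carrier M. \<phi> (smult M r x) = smult L r (\<phi> x)) \<and>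
        (\<forall>q. \<phi> ` component M q = component L q))"

text \<open>The free module on \<open>e\<^sub>i\<close>, \<open>i \<in> I\<close>, consists of the coefficient functions
  supported on \<open>I\<close>; for \<open>J \<subseteq> I\<close> the free module on \<open>J\<close> is thus literally a subset of
  the one on \<open>I\<close>. The degree of \<open>e\<^sub>i\<close> is \<open>b i\<close>.\<close>

definition unit_vec :: "nat \<Rightarrow> nat \<Rightarrow> 'a::ring_1" where
  "unit_vec i = (\<lambda>k. if k = i then 1 else 0)"

definition free_module ::
    "('k::field \<Rightarrow> 'a::ring_1 \<Rightarrow> 'a) \<Rightarrow> nat \<Rightarrow> (nat \<Rightarrow> 'a) \<Rightarrow> (nat \<Rightarrow> nat) \<Rightarrow> (nat \<Rightarrow> nat) \<Rightarrow>
     nat set \<Rightarrow> ('a, nat \<Rightarrow> 'a) graded_module" where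
  "free_module scale n a d b I =
     \<lparr>carrier = {v. \<forall>i. i \<notin> I \<longrightarrow> v i = 0},
      add = (+),
      zero = 0,
      smult = (\<lambda>r v k. r * v k),
      component = (\<lambda>q. module.span (\<lambda>c v k. scale c (v k))
        {(\<lambda>k. mono_pow n a \<alpha> * unit_vec i k) |\<alpha> i.
           \<alpha> \<in> exponents n \<and> i \<in> I \<and> exp_degree n d \<alpha> + b i = q})\<rparr>"


section \<open>The algorithm\<close>

text \<open>A state \<open>(V, E)\<close> is the list of the current vectors \<open>v\<^sub>1, \<dots>, v\<^sub>t\<close> together with the list
  \<open>[i\<^sub>1, \<dots>, i\<^sub>s\<^sub>']\<close> of the indices of the remaining basis vectors; the counters \<open>t\<close> and \<open>s'\<close>
  are the lengths of these lists, and re-indexing is deletion of list entries. The relation is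
  nondeterministic in the choice of \<open>v\<^sub>j\<close>.\<close>

inductive min_step ::
    "('k::field \<Rightarrow> 'a::ring_1 \<Rightarrow> 'a) \<Rightarrow>
     (nat \<Rightarrow> 'a) list \<times> nat list \<Rightarrow> (nat \<Rightarrow> 'a) list \<times> nat list \<Rightarrow> bool"
  for scale where
  "\<lbrakk>j < length V; p < length E;
    \<forall>q<p. (V ! j) (E ! q) \<notin> nonzero_scalars scale;
    c \<noteq> 0; (V ! j) (E ! p) = scale c 1;
    V' = map (\<lambda>l k. (V ! l) k - scale (1 / c) ((V ! l) (E ! p)) * (V ! j) k)
           ([0..<j] @ [Suc j..<length V])\<rbrakk>
   \<Longrightarrow> min_step scale (V, E) (filter (\<lambda>v. v \<noteq> 0) V', take p E @ drop (Suc p) E)"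

definition min_output ::
    "('k::field \<Rightarrow> 'a::ring_1 \<Rightarrow> 'a) \<Rightarrow> nat \<Rightarrow> (nat \<Rightarrow> 'a) list \<Rightarrow>
     (nat \<Rightarrow> 'a) list \<times> nat list \<Rightarrow> bool" where
  "min_output scale s U st \<longleftrightarrow>
     (min_step scale)\<^sup>*\<^sup>* (U, [0..<s]) st \<and> (\<nexists>st'. min_step scale st st')"

end

theory Submission
  imports Defs
begin

text \<open>One round of the algorithm uses a relation \<open>w\<close> whose \<open>i\<close>-th coefficient is a unit \<open>c\<close> and replaces
  every vector \<open>y\<close> by \<open>y - c\<^sup>-\<^sup>1 y\<^sub>i w\<close>. This map has values in the free module \<open>L'\<close> on the remaining
  basis vectors, is the identity there and changes \<open>y\<close> only by an element of \<open>N\<close>; hence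
  \<open>L\<^sub>0 = L' + N\<close> and \<open>N \<inter> L'\<close> is generated by the images of the old generators. As a nonzero scalar
  has degree \<open>0\<close>, the degree of \<open>w\<close> is that of \<open>e\<^sub>i\<close>, so the map preserves degrees. When
  no unit coefficient is left, all coefficients of elements of \<open>N \<inter> L'\<close> lie in the left ideal
  spanned by the monomials other than \<open>1\<close>. A redundant generator or a coincidence among the
  remaining \<open>e\<^sub>i\<close> would yield an element of \<open>N \<inter> L'\<close> with a coefficient \<open>1\<close>.\<close>

section \<open>Left submodules of coefficient functions\<close>

definition left_submodule :: "(nat \<Rightarrow> 'a::ring_1) set \<Rightarrow> bool" where
  "left_submodule H \<longleftrightarrow>
     0 \<in> H \<and> (\<forall>x\<in>H. \<forall>y\<in>H. x + y \<in> H) \<and> (\<forall>r. \<forall>x\<in>H. (\<lambda>k. r * x k) \<in> H)"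

text \<open>The span is formed among all coefficient functions, so it is the same whether the
  generators are viewed in the free module on \<open>I\<close> or on a smaller index set.\<close>

definition left_span :: "(nat \<Rightarrow> 'a::ring_1) set \<Rightarrow> (nat \<Rightarrow> 'a) set" where
  "left_span S = \<Inter>{H. left_submodule H \<and> S \<subseteq> H}"

definition supported :: "nat set \<Rightarrow> (nat \<Rightarrow> 'a::ring_1) set" where
  "supported I = {v. \<forall>i. i \<notin> I \<longrightarrow> v i = 0}"

lemma left_submoduleD:
  assumes "left_submodule H"
  shows "0 \<in> H" and "x \<in> H \<Longrightarrow> y \<in> H \<Longrightarrow> x + y \<in> H"
    and "x \<in> H \<Longrightarrow> (\<lambda>k. r * x k) \<in> H"
    and "x \<in> H \<Longrightarrow> - x \<in> H" and "x \<in> H \<Longrightarrow> y \<in> H \<Longrightarrow> x - y \<in> H"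
proof -
  show zero: "0 \<in> H" and add: "\<And>x y. x \<in> H \<Longrightarrow> y \<in> H \<Longrightarrow> x + y \<in> H"
    and mult: "\<And>r x. x \<in> H \<Longrightarrow> (\<lambda>k. r * x k) \<in> H"
    using assms by (auto simp: left_submodule_def)
  show neg: "- x \<in> H" if "x \<in> H" for x
    using mult[OF that, of "- 1"] by (simp add: fun_Compl_def)
  show "x - y \<in> H" if "x \<in> H" "y \<in> H" for x y
    using add[OF that(1) neg[OF that(2)]] by simp
qed

lemma left_submodule_left_span: "left_submodule (left_span S)"
  by (auto simp: left_submodule_def left_span_def)

lemma left_span_superset: "S \<subseteq> left_span S"
  by (auto simp: left_span_def)

lemma left_span_minimal: "left_submodule H \<Longrightarrow> S \<subseteq> H \<Longrightarrow> left_span S \<subseteq> H"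
  by (auto simp: left_span_def)

lemma left_span_mono: "S \<subseteq> T \<Longrightarrow> left_span S \<subseteq> left_span T"
  by (auto simp: left_span_def)

lemma left_submodule_supported: "left_submodule (supported I)"
  by (auto simp: left_submodule_def supported_def)

lemma left_submodule_Int: "left_submodule G \<Longrightarrow> left_submodule H \<Longrightarrow> left_submodule (G \<inter> H)"
  by (auto simp: left_submodule_def)

text \<open>The sums of an element of \<open>left_span S\<close> and an element of \<open>N\<close>
  already form a submodule, because \<open>N\<close> is one. This later turns a generator that is
  redundant modulo \<open>N\<close> into an actual element of \<open>N\<close>.\<close>

lemma left_span_Un_submodule:
  assumes N: "left_submodule N" and x: "x \<in> left_span (S \<union> N)"
  shows "\<exists>y\<in>left_span S. x - y \<in> N"
proof -
  note N' = left_submoduleD[OF N]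
  note S = left_submoduleD[OF left_submodule_left_span[of S]]
  let ?H = "{x. \<exists>y\<in>left_span S. x - y \<in> N}"
  have "left_submodule ?H"
    unfolding left_submodule_def
  proof (intro conjI ballI allI)
    show "0 \<in> ?H" using S(1) N'(1) by force
  next
    fix x x' assume "x \<in> ?H" "x' \<in> ?H"
    then obtain y y' where y: "y \<in> left_span S" "x - y \<in> N" "y' \<in> left_span S" "x' - y' \<in> N"
      by blast
    have "(x + x') - (y + y') \<in> N"
      using N'(2)[OF y(2,4)] by (simp add: algebra_simps)
    then show "x + x' \<in> ?H" using S(2)[OF y(1,3)] by blast
  next
    fix r x assume "x \<in> ?H"
    then obtain y where y: "y \<in> left_span S" "x - y \<in> N" by blast
    have "(\<lambda>k. r * x k) - (\<lambda>k. r * y k) = (\<lambda>k. r * (x - y) k)"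
      by (auto simp: algebra_simps)
    then have "(\<lambda>k. r * x k) - (\<lambda>k. r * y k) \<in> N"
      using N'(3)[OF y(2)] by simp
    then show "(\<lambda>k. r * x k) \<in> ?H" using S(3)[OF y(1)] by blast
  qed
  moreover have "S \<union> N \<subseteq> ?H"
  proof -
    have "x - x \<in> N" "x - 0 \<in> N \<longleftrightarrow> x \<in> N" for x using N'(1) by simp_all
    then show ?thesis using left_span_superset[of S] S(1) by blast
  qed
  ultimately show ?thesis using x left_span_minimal by blast
qed

text \<open>Induction on \<open>I\<close>: the coordinate at the new index is split off as a left
  multiple of its unit vector.\<close>

lemma supported_subset_left_span_unit_vec:
  assumes "finite I"
  shows "supported I \<subseteq> left_span (unit_vec ` I)"
proof
  note span = left_submoduleD[OF left_submodule_left_span]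
  fix x :: "nat \<Rightarrow> 'a"
  assume "x \<in> supported I"
  with assms show "x \<in> left_span (unit_vec ` I)"
  proof (induction I arbitrary: x rule: finite_induct)
    case empty
    then have "x = 0" by (auto simp: supported_def)
    show ?case unfolding \<open>x = 0\<close> by (rule span(1))
  next
    case (insert i I)
    let ?y = "\<lambda>k. if k = i then 0 else x k"
    have "?y \<in> left_span (unit_vec ` I)"
      using insert.prems by (intro insert.IH) (auto simp: supported_def)
    moreover have "left_span (unit_vec ` I) \<subseteq> left_span (unit_vec ` insert i I)"
      by (intro left_span_mono) auto
    moreover have "(\<lambda>k. x i * unit_vec i k) \<in> left_span (unit_vec ` insert i I)"
      by (intro span(3) subsetD[OF left_span_superset]) simp
    ultimately have "?y + (\<lambda>k. x i * unit_vec i k) \<in> left_span (unit_vec ` insert i I)"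
      by (intro span(2)) blast+
    moreover have "?y + (\<lambda>k. x i * unit_vec i k) = x"
      by (auto simp: unit_vec_def)
    ultimately show ?case by simp
  qed
qed

section \<open>Free modules, cosets and graded quotients\<close>

lemma free_module_simps:
  "carrier (free_module scale n a d b I) = supported I"
  "add (free_module scale n a d b I) = (+)"
  "zero (free_module scale n a d b I) = 0"
  "smult (free_module scale n a d b I) = (\<lambda>r v k. r * v k)"
  by (simp_all add: free_module_def supported_def)

text \<open>Intersecting only over submodules inside \<open>supported I\<close> loses nothing, since
  \<open>left_span S\<close> is itself such a submodule.\<close>

lemma generated_submodule_free_module:
  assumes "S \<subseteq> supported I"
  shows "generated_submodule (free_module scale n a d b I) S = left_span S"
proof -
  have sub: "is_submodule (free_module scale n a d b I) H \<longleftrightarrow> H \<subseteq> supported I \<and> left_submodule H" for H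
    by (auto simp: is_submodule_def free_module_simps left_submodule_def)
  have "left_span S \<subseteq> supported I"
    by (rule left_span_minimal[OF left_submodule_supported assms])
  then show ?thesis
    unfolding generated_submodule_def sub
    using left_submodule_left_span[of S] left_span_superset[of S] left_span_minimal[of _ S]
    by blast
qed

lemma coset_free_module: "coset (free_module scale n a d b I) N x = (+) x ` N"
  by (simp add: coset_def free_module_simps)

lemma coset_eq_iff:
  assumes "left_submodule N"
  shows "(+) x ` N = (+) y ` N \<longleftrightarrow> x - y \<in> N"
proof
  assume eq: "(+) x ` N = (+) y ` N"
  have "x + 0 \<in> (+) x ` N" using left_submoduleD(1)[OF assms] by blast
  then obtain h where "h \<in> N" "x + 0 = y + h" using eq by blast
  then show "x - y \<in> N" by (simp add: algebra_simps)
next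
  have sub: "(+) x ` N \<subseteq> (+) y ` N" if "x - y \<in> N" for x y
  proof
    fix z assume "z \<in> (+) x ` N"
    then obtain h where "h \<in> N" "z = x + h" by blast
    then have "z = y + ((x - y) + h)" by simp
    moreover have "(x - y) + h \<in> N"
      using left_submoduleD(2)[OF assms that] \<open>h \<in> N\<close> .
    ultimately show "z \<in> (+) y ` N" by blast
  qed
  assume "x - y \<in> N"
  moreover have "y - x \<in> N" using left_submoduleD(4)[OF assms \<open>x - y \<in> N\<close>] by simp
  ultimately show "(+) x ` N = (+) y ` N" using sub by blast
qed

text \<open>A modular law for cosets: once the representative \<open>y\<close> lies in
  \<open>C\<close>, an element \<open>y + h\<close> lies in \<open>C\<close> exactly when
  \<open>h\<close> does.\<close>

lemma coset_Int:
  assumes "left_submodule C" "y \<in> C" "left_submodule N" "x - y \<in> N"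
  shows "(+) x ` N \<inter> C = (+) y ` (N \<inter> C)"
proof -
  have "(+) x ` N \<inter> C = (+) y ` N \<inter> C"
    using coset_eq_iff assms(3,4) by metis
  also have "\<dots> = (+) y ` (N \<inter> C)"
  proof (intro equalityI subsetI)
    fix z assume z: "z \<in> (+) y ` N \<inter> C"
    then obtain h where h: "h \<in> N" "z = y + h" by blast
    then have "h = z - y" by simp
    then have "h \<in> C" using z assms(2) left_submoduleD(5)[OF assms(1)] by blast
    then show "z \<in> (+) y ` (N \<inter> C)" using h by blast
  qed (use assms(2) left_submoduleD(2)[OF assms(1)] in auto)
  finally show ?thesis .
qed

text \<open>Closure of \<open>N\<close> absorbs the error terms of representatives;
  \<open>0 \<in> N\<close> gives the reverse inclusions.\<close>

lemma quotient_free_module_simps: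
  fixes scale :: "'k::field \<Rightarrow> 'a::ring_1 \<Rightarrow> 'a"
    and n a d b I
  assumes "left_submodule N"
  defines "M \<equiv> quotient_module (free_module scale n a d b I) N"
  shows "carrier M = (\<lambda>x. (+) x ` N) ` supported I"
    and "zero M = (+) 0 ` N"
    and "add M ((+) x ` N) ((+) y ` N) = (+) (x + y) ` N"
    and "smult M r ((+) x ` N) = (+) (\<lambda>k. r * x k) ` N"
    and "component M q = (\<lambda>x. (+) x ` N) ` component (free_module scale n a d b I) q"
proof -
  note N = left_submoduleD[OF assms(1)]
  show "carrier M = (\<lambda>x. (+) x ` N) ` supported I"
    by (simp add: M_def quotient_module_def free_module_simps coset_free_module image_def)
  show "zero M = (+) 0 ` N"
    by (simp add: M_def quotient_module_def)
  show "component M q = (\<lambda>x. (+) x ` N) ` component (free_module scale n a d b I) q"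
    by (simp add: M_def quotient_module_def coset_free_module image_def)
  have "add M ((+) x ` N) ((+) y ` N) = {u + v |u v. u \<in> (+) x ` N \<and> v \<in> (+) y ` N}"
    by (simp add: M_def quotient_module_def free_module_simps)
  also have "\<dots> = (+) (x + y) ` N"
  proof (intro equalityI subsetI)
    fix z assume "z \<in> {u + v |u v. u \<in> (+) x ` N \<and> v \<in> (+) y ` N}"
    then obtain g h where "g \<in> N" "h \<in> N" "z = (x + g) + (y + h)" by blast
    then have "z = (x + y) + (g + h)" "g + h \<in> N" using N(2) by (simp_all add: algebra_simps)
    then show "z \<in> (+) (x + y) ` N" by blast
  next
    fix z assume "z \<in> (+) (x + y) ` N"
    then obtain h where "h \<in> N" "z = (x + h) + (y + 0)" by (auto simp: algebra_simps)
    then show "z \<in> {u + v |u v. u \<in> (+) x ` N \<and> v \<in> (+) y ` N}" using N(1) by blast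
  qed
  finally show "add M ((+) x ` N) ((+) y ` N) = (+) (x + y) ` N" .
  have "smult M r ((+) x ` N) = {(\<lambda>k. r * u k) + h |u h. u \<in> (+) x ` N \<and> h \<in> N}"
    by (simp add: M_def quotient_module_def free_module_simps)
  also have "\<dots> = (+) (\<lambda>k. r * x k) ` N"
  proof (intro equalityI subsetI)
    fix z assume "z \<in> {(\<lambda>k. r * u k) + h |u h. u \<in> (+) x ` N \<and> h \<in> N}"
    then obtain g h where gh: "g \<in> N" "h \<in> N" "z = (\<lambda>k. r * (x + g) k) + h" by blast
    then have "z = (\<lambda>k. r * x k) + ((\<lambda>k. r * g k) + h)"
      by (auto simp: algebra_simps)
    moreover have "(\<lambda>k. r * g k) + h \<in> N" using N(2,3) gh by blast
    ultimately show "z \<in> (+) (\<lambda>k. r * x k) ` N" by blast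
  next
    fix z assume "z \<in> (+) (\<lambda>k. r * x k) ` N"
    then obtain h where "h \<in> N" "z = (\<lambda>k. r * (x + 0) k) + h" by auto
    then show "z \<in> {(\<lambda>k. r * u k) + h |u h. u \<in> (+) x ` N \<and> h \<in> N}" using N(1) by blast
  qed
  finally show "smult M r ((+) x ` N) = (+) (\<lambda>k. r * x k) ` N" .
qed

text \<open>The isomorphism \<open>(L' + N) / N \<cong> L' / (N \<inter> L')\<close> sends a coset to its intersection with
  \<open>L'\<close>.\<close>

lemma graded_isomorphic_quotient_Int:
  fixes scale :: "'k::field \<Rightarrow> 'a::ring_1 \<Rightarrow> 'a"
    and n a d b
  defines "L \<equiv> free_module scale n a d b"
  assumes N: "left_submodule N" and "J \<subseteq> I"
    and comp_subset: "\<And>q. component (L J) q \<subseteq> supported J"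
      "\<And>q. component (L J) q \<subseteq> component (L I) q"
    and decomp: "\<And>x. x \<in> supported I \<Longrightarrow> \<exists>y\<in>supported J. x - y \<in> N"
    and comp_decomp:
      "\<And>q x. x \<in> component (L I) q \<Longrightarrow> \<exists>y\<in>component (L J) q. x - y \<in> N"
  shows "graded_isomorphic (quotient_module (L I) N) (quotient_module (L J) (N \<inter> supported J))"
proof -
  let ?C = "supported J :: (nat \<Rightarrow> 'a) set"
  let ?\<phi> = "\<lambda>X. X \<inter> ?C"
  note C = left_submodule_supported[of J]
  note NC = left_submodule_Int[OF N C]
  note M = quotient_free_module_simps[OF N, of scale n a d b I, folded L_def]
  note M' = quotient_free_module_simps[OF NC, of scale n a d b J, folded L_def]
  \<comment> \<open>Every intersection with \<open>?C\<close> below is computed from a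
    representative in \<open>?C\<close>.\<close>
  have phi: "?\<phi> ((+) x ` N) = (+) y ` (N \<inter> ?C)" if "y \<in> ?C" "x - y \<in> N" for x y
    by (rule coset_Int[OF C that(1) N that(2)])
  have CI: "?C \<subseteq> supported I" using \<open>J \<subseteq> I\<close> by (auto simp: supported_def)
  have self: "x - x \<in> N" for x using left_submoduleD(1)[OF N] by simp
  show ?thesis
    unfolding graded_isomorphic_def
  proof (intro exI[of _ ?\<phi>] conjI allI ballI)
    show "bij_betw ?\<phi> (carrier (quotient_module (L I) N))
        (carrier (quotient_module (L J) (N \<inter> ?C)))"
      unfolding bij_betw_def
    proof
      show "inj_on ?\<phi> (carrier (quotient_module (L I) N))"
      proof (rule inj_onI)
        fix X X' assume "X \<in> carrier (quotient_module (L I) N)"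
          "X' \<in> carrier (quotient_module (L I) N)" and eq: "?\<phi> X = ?\<phi> X'"
        then obtain x x' where x: "x \<in> supported I" "X = (+) x ` N"
          "x' \<in> supported I" "X' = (+) x' ` N" unfolding M by blast
        obtain y y' where y: "y \<in> ?C" "x - y \<in> N" "y' \<in> ?C" "x' - y' \<in> N"
          using decomp[OF x(1)] decomp[OF x(3)] by blast
        have "(+) y ` (N \<inter> ?C) = (+) y' ` (N \<inter> ?C)"
          using eq unfolding x phi[OF y(1,2)] phi[OF y(3,4)] .
        then have "y - y' \<in> N" unfolding coset_eq_iff[OF NC] by simp
        \<comment> \<open>The expression telescopes to \<open>x - x'\<close>.\<close>
        then have "(x - y) + (y - y') - (x' - y') \<in> N"
          using left_submoduleD(5)[OF N left_submoduleD(2)[OF N y(2)] y(4)] by blast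
        then show "X = X'" unfolding x coset_eq_iff[OF N] by (simp add: algebra_simps)
      qed
      show "?\<phi> ` carrier (quotient_module (L I) N) = carrier (quotient_module (L J) (N \<inter> ?C))"
      proof (intro equalityI subsetI)
        fix Y assume "Y \<in> ?\<phi> ` carrier (quotient_module (L I) N)"
        then obtain x where x: "x \<in> supported I" "Y = ?\<phi> ((+) x ` N)" unfolding M by blast
        obtain y where y: "y \<in> ?C" "x - y \<in> N" using decomp[OF x(1)] by blast
        show "Y \<in> carrier (quotient_module (L J) (N \<inter> ?C))"
          unfolding M' x(2) phi[OF y] using y(1) by (rule imageI)
      next
        fix Y assume "Y \<in> carrier (quotient_module (L J) (N \<inter> ?C))"
        then obtain y where y: "y \<in> ?C" "Y = (+) y ` (N \<inter> ?C)" unfolding M' by blast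
        show "Y \<in> ?\<phi> ` carrier (quotient_module (L I) N)"
          unfolding M y(2) phi[OF y(1) self, symmetric] using y(1) CI by (intro imageI) blast
      qed
    qed
  next
    fix X X' assume "X \<in> carrier (quotient_module (L I) N)"
      "X' \<in> carrier (quotient_module (L I) N)"
    then obtain x x' where x: "x \<in> supported I" "X = (+) x ` N"
      "x' \<in> supported I" "X' = (+) x' ` N" unfolding M by blast
    obtain y y' where y: "y \<in> ?C" "x - y \<in> N" "y' \<in> ?C" "x' - y' \<in> N"
      using decomp[OF x(1)] decomp[OF x(3)] by blast
    have "(x + x') - (y + y') \<in> N"
      using left_submoduleD(2)[OF N y(2,4)] by (simp add: algebra_simps)
    moreover have "y + y' \<in> ?C" using left_submoduleD(2)[OF C] y by blast
    ultimately show "?\<phi> (add (quotient_module (L I) N) X X') =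
        add (quotient_module (L J) (N \<inter> ?C)) (?\<phi> X) (?\<phi> X')"
      using y by (simp add: x M M' phi)
  next
    fix r X assume "X \<in> carrier (quotient_module (L I) N)"
    then obtain x where x: "x \<in> supported I" "X = (+) x ` N" unfolding M by blast
    obtain y where y: "y \<in> ?C" "x - y \<in> N" using decomp[OF x(1)] by blast
    have "(\<lambda>k. r * x k) - (\<lambda>k. r * y k) = (\<lambda>k. r * (x - y) k)"
      by (auto simp: algebra_simps)
    then have "(\<lambda>k. r * x k) - (\<lambda>k. r * y k) \<in> N"
      using left_submoduleD(3)[OF N y(2)] by simp
    moreover have "(\<lambda>k. r * y k) \<in> ?C" using left_submoduleD(3)[OF C] y by blast
    ultimately show "?\<phi> (smult (quotient_module (L I) N) r X) =
        smult (quotient_module (L J) (N \<inter> ?C)) r (?\<phi> X)"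
      using y by (simp add: x M M' phi)
  next
    fix q
    show "?\<phi> ` component (quotient_module (L I) N) q =
        component (quotient_module (L J) (N \<inter> ?C)) q"
    proof (intro equalityI subsetI)
      fix Y assume "Y \<in> ?\<phi> ` component (quotient_module (L I) N) q"
      then obtain x where x: "x \<in> component (L I) q" "Y = ?\<phi> ((+) x ` N)" unfolding M by blast
      \<comment> \<open>A homogeneous coset has a representative of the same degree in the smaller
        free module, so the map respects degrees.\<close>
      obtain y where y: "y \<in> component (L J) q" "x - y \<in> N" using comp_decomp[OF x(1)] by blast
      have "y \<in> ?C" using y(1) comp_subset(1) by blast
      then show "Y \<in> component (quotient_module (L J) (N \<inter> ?C)) q"
        unfolding M' x(2) phi[OF \<open>y \<in> ?C\<close> y(2)] using y(1) by (intro imageI)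
    next
      fix Y assume "Y \<in> component (quotient_module (L J) (N \<inter> ?C)) q"
      then obtain y where y: "y \<in> component (L J) q" "Y = (+) y ` (N \<inter> ?C)" unfolding M' by blast
      have "y \<in> ?C" using y(1) comp_subset(1) by blast
      then show "Y \<in> ?\<phi> ` component (quotient_module (L I) N) q"
        unfolding M y(2) phi[OF \<open>y \<in> ?C\<close> self, symmetric]
        using y(1) comp_subset(2) by (intro imageI) blast
    qed
  qed
qed

text \<open>Submodules of the quotient correspond to submodules containing \<open>N\<close>.
  Generation is thereby moved to the free module, where redundancy can be tested on
  coefficients.\<close>

lemma generated_quotient_eq_carrier_iff:
  fixes scale :: "'k::field \<Rightarrow> 'a::ring_1 \<Rightarrow> 'a"
    and n a d b I
  assumes N: "left_submodule N" "N \<subseteq> supported I" and G: "G \<subseteq> supported I"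
  defines "M \<equiv> quotient_module (free_module scale n a d b I) N"
  shows "generated_submodule M ((\<lambda>x. (+) x ` N) ` G) = carrier M \<longleftrightarrow>
    supported I \<subseteq> left_span (G \<union> N)"
proof -
  note M = quotient_free_module_simps[OF N(1), of scale n a d b I, folded M_def]
  let ?c = "\<lambda>x. (+) x ` N"
  show ?thesis
  proof
    assume gen: "generated_submodule M (?c ` G) = carrier M"
    note span = left_submoduleD[OF left_submodule_left_span]
    have span_I: "left_span (G \<union> N) \<subseteq> supported I"
      using left_span_minimal[OF left_submodule_supported] G N(2) by blast
    \<comment> \<open>The image of the span is a submodule containing the generators, so by
      \<open>gen\<close> it is all of \<open>M\<close>.\<close>
    have "is_submodule M (?c ` left_span (G \<union> N))"
      unfolding is_submodule_def M(1,2)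
    proof (intro conjI ballI allI)
      show "?c ` left_span (G \<union> N) \<subseteq> ?c ` supported I" using span_I by blast
      show "?c 0 \<in> ?c ` left_span (G \<union> N)" using span(1) by blast
    next
      fix r X assume "X \<in> ?c ` left_span (G \<union> N)"
      then obtain x where x: "x \<in> left_span (G \<union> N)" "X = ?c x" by blast
      show "smult M r X \<in> ?c ` left_span (G \<union> N)"
        unfolding x(2) M(4) by (intro imageI span(3) x(1))
    next
      fix X Y assume "X \<in> ?c ` left_span (G \<union> N)" "Y \<in> ?c ` left_span (G \<union> N)"
      then obtain x y where x: "x \<in> left_span (G \<union> N)" "X = ?c x"
        and y: "y \<in> left_span (G \<union> N)" "Y = ?c y" by blast
      show "add M X Y \<in> ?c ` left_span (G \<union> N)"
        unfolding x(2) y(2) M(3) by (intro imageI span(2) x(1) y(1))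
    qed
    moreover have "?c ` G \<subseteq> ?c ` left_span (G \<union> N)"
      using left_span_superset by blast
    ultimately have sub: "carrier M \<subseteq> ?c ` left_span (G \<union> N)"
      using gen unfolding generated_submodule_def by blast
    show "supported I \<subseteq> left_span (G \<union> N)"
    proof
      fix x :: "nat \<Rightarrow> 'a" assume "x \<in> supported I"
      then have "?c x \<in> ?c ` left_span (G \<union> N)" using sub M(1) by blast
      then obtain y where y: "y \<in> left_span (G \<union> N)" "?c x = ?c y" by blast
      \<comment> \<open>Equality of cosets determines \<open>x\<close> only up to \<open>N\<close>,
        which is why \<open>N\<close> is added to the generators.\<close>
      then have "x - y \<in> left_span (G \<union> N)"
        using coset_eq_iff[OF N(1)] left_span_superset by blast
      then show "x \<in> left_span (G \<union> N)" using span(2)[OF _ y(1)] by fastforce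
    qed
  next
    assume sup: "supported I \<subseteq> left_span (G \<union> N)"
    have "carrier M \<subseteq> H" if H: "is_submodule M H" "?c ` G \<subseteq> H" for H
    proof -
      \<comment> \<open>Conversely, the preimage of \<open>H\<close> is a submodule; it contains
        \<open>N\<close> because elements of \<open>N\<close> have the zero coset.\<close>
      have "left_submodule {x. ?c x \<in> H}"
        unfolding left_submodule_def
        using H(1) unfolding is_submodule_def M(2)
        by (auto simp: M(3,4)[symmetric])
      moreover have "G \<union> N \<subseteq> {x. ?c x \<in> H}"
      proof -
        have "?c x = ?c 0" if "x \<in> N" for x
          using that coset_eq_iff[OF N(1), of x 0] by simp
        then show ?thesis using H unfolding is_submodule_def M(2) by auto
      qed
      ultimately have "left_span (G \<union> N) \<subseteq> {x. ?c x \<in> H}" by (rule left_span_minimal)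
      then show ?thesis unfolding M(1) using sup by blast
    qed
    \<comment> \<open>This puts the whole carrier among the intersected submodules and so gives the
      reverse inclusion.\<close>
    moreover have "is_submodule M (carrier M)"
    proof -
      note S = left_submoduleD[OF left_submodule_supported[of I]]
      show ?thesis
        unfolding is_submodule_def M(1,2)
      proof (intro conjI ballI allI order_refl imageI S(1))
        fix r X assume "X \<in> ?c ` supported I"
        then obtain x where x: "x \<in> supported I" "X = ?c x" by blast
        show "smult M r X \<in> ?c ` supported I"
          unfolding x(2) M(4) by (intro imageI S(3) x(1))
      next
        fix X Y assume "X \<in> ?c ` supported I" "Y \<in> ?c ` supported I"
        then obtain x y where x: "x \<in> supported I" "X = ?c x"
          and y: "y \<in> supported I" "Y = ?c y" by blast
        show "add M X Y \<in> ?c ` supported I"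
          unfolding x(2) y(2) M(3) by (intro imageI S(2) x(1) y(1))
      qed
    qed
    moreover have "?c ` G \<subseteq> carrier M" unfolding M(1) using G by blast
    ultimately show "generated_submodule M (?c ` G) = carrier M"
      unfolding generated_submodule_def by blast
  qed
qed

text \<open>The multiple of \<open>w\<close> is taken from the left, so the map is left linear in
  \<open>y\<close> although the ring need not be commutative.\<close>

definition eliminate ::
    "('k::field \<Rightarrow> 'a::ring_1 \<Rightarrow> 'a) \<Rightarrow> 'k \<Rightarrow> nat \<Rightarrow> (nat \<Rightarrow> 'a) \<Rightarrow> (nat \<Rightarrow> 'a) \<Rightarrow> nat \<Rightarrow> 'a" where
  "eliminate scale c i w y = (\<lambda>k. y k - scale (1 / c) (y i) * w k)"

section \<open>Degree zero and positive degree in the algebra\<close>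

locale weighted_graded_algebra = assoc_algebra scale
  for scale :: "'k::field \<Rightarrow> 'a::ring_1 \<Rightarrow> 'a" +
  fixes n :: nat and a :: "nat \<Rightarrow> 'a" and d :: "nat \<Rightarrow> nat"
  assumes basis: "has_monomial_basis scale n a"
    and graded: "weighted_graded scale n a d"
begin

abbreviation "alg_comp \<equiv> algebra_component scale n a d"

text \<open>The analogue of the irrelevant ideal of a graded polynomial ring, a linear complement of
  the scalars.\<close>

definition positive_part :: "'a set" where
  "positive_part = span (monomials n a - {1})"

lemma mono_pow_0: "mono_pow n a (\<lambda>_. 0) = 1"
proof -
  have "prod_list (map (\<lambda>i. 1 :: 'a) xs) = 1" for xs :: "nat list"
    by (induction xs) auto
  then show ?thesis by (simp add: mono_pow_def)
qed

lemma zero_exponents: "(\<lambda>_. 0) \<in> exponents n"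
  by (simp add: exponents_def)

text \<open>The weights \<open>d i\<close> with \<open>i < n\<close> are positive, so no nonzero
  exponent is hidden by a zero weight.\<close>

lemma exp_degree_eq_0_iff:
  assumes "\<alpha> \<in> exponents n"
  shows "exp_degree n d \<alpha> = 0 \<longleftrightarrow> \<alpha> = (\<lambda>_. 0)"
proof
  assume "exp_degree n d \<alpha> = 0"
  then have "\<forall>i<n. d i = 0 \<or> \<alpha> i = 0" by (simp add: exp_degree_def)
  then have "\<forall>i<n. \<alpha> i = 0" using graded unfolding weighted_graded_def by (metis less_irrefl)
  then show "\<alpha> = (\<lambda>_. 0)"
    using assms by (auto simp: exponents_def fun_eq_iff) (meson not_le)
qed (simp add: exp_degree_def)

lemma mono_pow_in_alg_comp:
  "\<alpha> \<in> exponents n \<Longrightarrow> mono_pow n a \<alpha> \<in> alg_comp (exp_degree n d \<alpha>)"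
  unfolding algebra_component_def by (intro span_base) auto

lemma subspace_alg_comp: "subspace (alg_comp p)"
  unfolding algebra_component_def by (rule subspace_span)

lemma alg_comp_0: "alg_comp 0 = range (\<lambda>c. scale c 1)"
proof -
  have "{mono_pow n a \<alpha> |\<alpha>. \<alpha> \<in> exponents n \<and> exp_degree n d \<alpha> = 0} = {1}"
    using exp_degree_eq_0_iff zero_exponents mono_pow_0 by auto
  then show ?thesis by (simp add: algebra_component_def span_singleton)
qed

lemma alg_comp_mult: "x \<in> alg_comp p \<Longrightarrow> y \<in> alg_comp q \<Longrightarrow> x * y \<in> alg_comp (p + q)"
  using graded by (auto simp: weighted_graded_def)

lemma one_in_monomials: "1 \<in> monomials n a"
  using zero_exponents mono_pow_0 by (force simp: monomials_def)

text \<open>As \<open>1\<close> is itself a basis monomial, this is linear independence of the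
  monomials.\<close>

lemma one_notin_positive_part: "1 \<notin> positive_part"
  using basis one_in_monomials
  by (auto simp: has_monomial_basis_def positive_part_def dependent_def)

lemma mono_pow_neq_1: "\<alpha> \<in> exponents n \<Longrightarrow> \<alpha> \<noteq> (\<lambda>_. 0) \<Longrightarrow> mono_pow n a \<alpha> \<noteq> 1"
  using basis zero_exponents mono_pow_0 by (auto simp: has_monomial_basis_def inj_on_def)

lemma alg_comp_subset_positive_part: "0 < p \<Longrightarrow> alg_comp p \<subseteq> positive_part"
  unfolding algebra_component_def positive_part_def
proof (intro span_mono subsetI)
  fix x assume "0 < p" "x \<in> {mono_pow n a \<alpha> |\<alpha>. \<alpha> \<in> exponents n \<and> exp_degree n d \<alpha> = p}"
  then obtain \<alpha> where "\<alpha> \<in> exponents n" "exp_degree n d \<alpha> \<noteq> 0" "x = mono_pow n a \<alpha>" by auto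
  then show "x \<in> monomials n a - {1}"
    using mono_pow_neq_1[of \<alpha>] exp_degree_eq_0_iff[of \<alpha>] by (auto simp: monomials_def)
qed

text \<open>In positive degree the scalar, and after division by \<open>c\<close> also
  \<open>1\<close>, would lie in \<open>positive_part\<close>. This fixes the degree of a relation
  from its pivot.\<close>

lemma alg_comp_degree_0:
  assumes "c \<noteq> 0" "scale c 1 \<in> alg_comp p"
  shows "p = 0"
proof (rule ccontr)
  assume "p \<noteq> 0"
  then have "scale c 1 \<in> positive_part" using assms(2) alg_comp_subset_positive_part by blast
  then have "scale (1 / c) (scale c 1) \<in> positive_part"
    unfolding positive_part_def by (rule span_scale)
  then show False using one_notin_positive_part assms(1) by simp
qed

text \<open>A dichotomy by degree: degree \<open>0\<close> consists of scalars, of which only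
  \<open>0\<close> is left, and positive degrees lie in \<open>positive_part\<close>.\<close>

lemma alg_comp_cases:
  assumes "x \<in> alg_comp p" "x \<notin> nonzero_scalars scale"
  shows "x \<in> positive_part"
proof (cases "p = 0")
  case True
  then obtain c where "x = scale c 1" using assms(1) alg_comp_0 by auto
  then have "x = 0" using assms(2) by (cases "c = 0") (auto simp: nonzero_scalars_def)
  then show ?thesis by (simp add: positive_part_def span_zero)
next
  case False
  then show ?thesis using assms(1) alg_comp_subset_positive_part by blast
qed

text \<open>By bilinearity it suffices to multiply monomials; there degrees add, and the right
  factor contributes a positive degree.\<close>

lemma positive_part_mult:
  assumes "y \<in> positive_part"
  shows "r * y \<in> positive_part"
proof -
  have mono: "u * v \<in> positive_part"
    if "u \<in> monomials n a" "v \<in> monomials n a - {1}" for u v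
  proof -
    obtain \<alpha> \<beta> where \<alpha>: "\<alpha> \<in> exponents n" "u = mono_pow n a \<alpha>"
      and \<beta>: "\<beta> \<in> exponents n" "v = mono_pow n a \<beta>"
      using \<open>u \<in> monomials n a\<close> \<open>v \<in> monomials n a - {1}\<close> by (auto simp: monomials_def)
    have "u * v \<in> alg_comp (exp_degree n d \<alpha> + exp_degree n d \<beta>)"
      unfolding \<alpha> \<beta> by (intro alg_comp_mult mono_pow_in_alg_comp \<alpha> \<beta>)
    moreover have "exp_degree n d \<beta> \<noteq> 0"
      using exp_degree_eq_0_iff \<beta> that(2) mono_pow_0 by auto
    ultimately show ?thesis
      using alg_comp_subset_positive_part[of "exp_degree n d \<alpha> + exp_degree n d \<beta>"] by auto
  qed
  \<comment> \<open>Linearity in the left factor comes first, by expanding \<open>r\<close> in the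
    monomial basis; linearity in the right factor concludes.\<close>
  have left: "r * v \<in> positive_part" if "v \<in> monomials n a - {1}" for v
  proof -
    have "r \<in> span (monomials n a)" using basis by (simp add: has_monomial_basis_def)
    then show ?thesis
    proof (induction rule: span_induct)
      case base
      show ?case unfolding subspace_def positive_part_def
        by (auto simp: span_zero span_add span_scale distrib_right scale_mult_left)
    next
      case (step u)
      then show ?case using mono[OF _ that] by simp
    qed
  qed
  show ?thesis
    using assms unfolding positive_part_def
  proof (induction rule: span_induct)
    case base
    show ?case unfolding subspace_def
      by (auto simp: span_zero span_add span_scale distrib_left scale_mult_right)
  next
    case (step v)
    then show ?case using left by (simp add: positive_part_def)
  qed
qed

text \<open>The left ideal property allows positivity of a coefficient to be checked on generators
  alone.\<close>

lemma left_submodule_coeff_positive: "left_submodule {x. x i \<in> positive_part}"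
  using positive_part_mult
  by (auto simp: left_submodule_def positive_part_def span_zero span_add)

section \<open>Homogeneous components in coordinates\<close>

text \<open>The test \<open>b i \<le> q\<close> keeps the truncated difference
  \<open>q - b i\<close> from reading a negative degree as degree \<open>0\<close>.\<close>

definition vec_comp :: "(nat \<Rightarrow> nat) \<Rightarrow> nat set \<Rightarrow> nat \<Rightarrow> (nat \<Rightarrow> 'a) set" where
  "vec_comp b I q = {v. \<forall>i. if i \<in> I \<and> b i \<le> q then v i \<in> alg_comp (q - b i) else v i = 0}"

lemma vector_space_fun: "vector_space (\<lambda>c (v :: nat \<Rightarrow> 'a) k. scale c (v k))"
  by unfold_locales (auto simp: fun_eq_iff scale_left_distrib scale_right_distrib)

text \<open>The spanning vectors are homogeneous in each coordinate. Conversely, as \<open>I\<close>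
  is finite, a vector is the sum of its coordinates, each spanned by monomials of the right
  degree.\<close>

lemma component_free_module:
  assumes "finite I"
  shows "component (free_module scale n a d b I) q = vec_comp b I q"
proof -
  interpret fs: vector_space "\<lambda>c (v :: nat \<Rightarrow> 'a) k. scale c (v k)"
    by (rule vector_space_fun)
  define B :: "(nat \<Rightarrow> 'a) set" where "B = {(\<lambda>k. mono_pow n a \<alpha> * unit_vec i k) |\<alpha> i.
           \<alpha> \<in> exponents n \<and> i \<in> I \<and> exp_degree n d \<alpha> + b i = q}"
  have comp: "component (free_module scale n a d b I) q = fs.span B"
    by (simp add: free_module_def B_def)
  have "fs.subspace (vec_comp b I q)"
    unfolding fs.subspace_def vec_comp_def
    using subspace_alg_comp by (auto simp: subspace_def)
  moreover have "B \<subseteq> vec_comp b I q"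
    using mono_pow_in_alg_comp subspace_0[OF subspace_alg_comp]
    by (fastforce simp: B_def vec_comp_def unit_vec_def)
  ultimately have "fs.span B \<subseteq> vec_comp b I q" by (rule fs.span_minimal[rotated])
  moreover have "v \<in> fs.span B" if v: "v \<in> vec_comp b I q" for v
  proof -
    \<comment> \<open>One coordinate: linear extension from monomials of degree
      \<open>q - b i\<close>, where \<open>b i \<le> q\<close> restores
      \<open>exp_degree n d \<alpha> + b i = q\<close>.\<close>
    have single: "(\<lambda>k. x * unit_vec i k) \<in> fs.span B"
      if "i \<in> I" "b i \<le> q" "x \<in> alg_comp (q - b i)" for x i
      using that(3) unfolding algebra_component_def
    proof (induction rule: span_induct)
      case base
      have "(\<lambda>k. (x + y) * unit_vec i k) = (\<lambda>k. x * unit_vec i k) + (\<lambda>k. y * unit_vec i k)" for x y :: 'a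
        by (auto simp: distrib_right)
      moreover have "(\<lambda>k. 0 * unit_vec i k) = (0 :: nat \<Rightarrow> 'a)" by auto
      ultimately show ?case
        using fs.span_zero fs.span_add fs.span_scale
        by (simp add: subspace_def scale_mult_left)
    next
      case (step x)
      then obtain \<alpha> where "x = mono_pow n a \<alpha>" "\<alpha> \<in> exponents n" "exp_degree n d \<alpha> + b i = q"
        using \<open>b i \<le> q\<close> by auto
      then show ?case using \<open>i \<in> I\<close> unfolding B_def by (intro fs.span_base) blast
    qed
    have "v = (\<Sum>i\<in>I. (\<lambda>k. v i * unit_vec i k))"
    proof
      fix k
      have "(\<Sum>i\<in>I. (\<lambda>k. v i * unit_vec i k)) k = (\<Sum>i\<in>I. v i * unit_vec i k)"
        by (induction I rule: infinite_finite_induct) auto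
      also have "\<dots> = (\<Sum>i\<in>I. if i = k then v i else 0)"
        by (intro sum.cong) (auto simp: unit_vec_def)
      also have "\<dots> = v k"
        using assms v by (auto simp: vec_comp_def split: if_splits)
      finally show "v k = (\<Sum>i\<in>I. (\<lambda>k. v i * unit_vec i k)) k" by simp
    qed
    also have "\<dots> \<in> fs.span B"
    proof (rule fs.span_sum)
      fix i assume "i \<in> I"
      show "(\<lambda>k. v i * unit_vec i k) \<in> fs.span B"
      proof (cases "b i \<le> q")
        case True
        then show ?thesis using single \<open>i \<in> I\<close> v by (simp add: vec_comp_def)
      next
        case False
        then have "v i = 0" using v unfolding vec_comp_def by (auto split: if_splits)
        then have "(\<lambda>k. v i * unit_vec i k) = 0" by auto
        then show ?thesis using fs.span_zero by simp
      qed
    qed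
    finally show ?thesis .
  qed
  ultimately show ?thesis using comp by blast
qed

lemma vec_comp_subset_supported: "vec_comp b I q \<subseteq> supported I"
  by (auto simp: vec_comp_def supported_def)

lemma vec_comp_mono:
  assumes "J \<subseteq> I"
  shows "vec_comp b J q \<subseteq> vec_comp b I q"
proof
  fix v assume v: "v \<in> vec_comp b J q"
  have "if i \<in> I \<and> b i \<le> q then v i \<in> alg_comp (q - b i) else v i = 0" for i
  proof -
    have "if i \<in> J \<and> b i \<le> q then v i \<in> alg_comp (q - b i) else v i = 0"
      using v unfolding vec_comp_def by blast
    \<comment> \<open>An index in \<open>I\<close> outside \<open>J\<close> has coefficient
      \<open>0\<close>, which is homogeneous of every degree.\<close>
    then show ?thesis
      using assms subspace_0[OF subspace_alg_comp, of "q - b i"] by (auto split: if_splits)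
  qed
  then show "v \<in> vec_comp b I q" unfolding vec_comp_def by blast
qed

lemma vec_comp_coeff_positive:
  assumes "v \<in> vec_comp b I q" "v i \<notin> nonzero_scalars scale"
  shows "v i \<in> positive_part"
proof (cases "v i = 0")
  case True
  then show ?thesis by (simp add: positive_part_def span_zero)
next
  case False
  then have "v i \<in> alg_comp (q - b i)"
    using assms(1) unfolding vec_comp_def by (auto split: if_splits)
  then show ?thesis using assms(2) by (rule alg_comp_cases)
qed

lemma unit_vec_in_vec_comp: "i \<in> I \<Longrightarrow> unit_vec i \<in> vec_comp b I (b i)"
  using subspace_0[OF subspace_alg_comp] mono_pow_in_alg_comp[OF zero_exponents]
  by (auto simp: vec_comp_def unit_vec_def mono_pow_0 exp_degree_def)

section \<open>Elimination with a unit pivot\<close>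

text \<open>Scalars commute past \<open>y i\<close>, so \<open>1 / c\<close> and \<open>c\<close>
  cancel.\<close>

lemma eliminate_at:
  assumes "c \<noteq> 0" "w i = scale c 1"
  shows "eliminate scale c i w y i = 0"
  using assms by (simp add: eliminate_def scale_mult_right)

text \<open>This is what allows the algorithm to drop the pivot vector: its own image would only be
  \<open>0\<close>.\<close>

lemma eliminate_self:
  assumes "c \<noteq> 0" "w i = scale c 1"
  shows "eliminate scale c i w w = 0"
  using assms by (auto simp: eliminate_def)

lemma diff_eliminate: "y - eliminate scale c i w y = (\<lambda>k. scale (1 / c) (y i) * w k)"
  by (auto simp: eliminate_def)

lemma eliminate_supported:
  assumes "c \<noteq> 0" "w i = scale c 1" "w \<in> supported I" "y \<in> supported I"
  shows "eliminate scale c i w y \<in> supported (I - {i})"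
  using eliminate_at[of c w i y, OF assms(1,2)] assms(3,4) by (auto simp: supported_def eliminate_def)

text \<open>The pivot \<open>w i\<close> has degree \<open>0\<close>, so \<open>w\<close> has degree
  \<open>b i\<close> and the subtracted multiple has the degree of \<open>y\<close>.\<close>

lemma eliminate_vec_comp:
  assumes c: "c \<noteq> 0" "w i = scale c 1" and w: "w \<in> vec_comp b I p" and y: "y \<in> vec_comp b I q"
  shows "eliminate scale c i w y \<in> vec_comp b (I - {i}) q"
proof -
  have "w i \<noteq> 0" using c by simp
  then have i: "i \<in> I" "b i \<le> p" "w i \<in> alg_comp (p - b i)"
    using w unfolding vec_comp_def by (auto split: if_splits)
  \<comment> \<open>A nonzero scalar in degree \<open>p - b i\<close> forces this difference to be
    \<open>0\<close>; as it is truncated, equality also needs \<open>b i \<le> p\<close>.\<close>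
  then have p: "p = b i" using alg_comp_degree_0 c by fastforce
  have "if k \<in> I \<and> b k \<le> q then eliminate scale c i w y k \<in> alg_comp (q - b k)
      else eliminate scale c i w y k = 0" for k
  proof (cases "y i = 0 \<or> w k = 0")
    case True
    then have "eliminate scale c i w y k = y k" by (auto simp: eliminate_def)
    then show ?thesis using y by (simp add: vec_comp_def)
  next
    case False
    then have yi: "b i \<le> q" "y i \<in> alg_comp (q - b i)"
      using y unfolding vec_comp_def by (auto split: if_splits)
    have wk: "k \<in> I" "b k \<le> b i" "w k \<in> alg_comp (b i - b k)"
      using w False unfolding vec_comp_def p by (auto split: if_splits)
    \<comment> \<open>Since \<open>b k \<le> b i \<le> q\<close>, the two truncated differences add
      up to \<open>q - b k\<close>.\<close>
    have "scale (1 / c) (y i) * w k \<in> alg_comp ((q - b i) + (b i - b k))"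
      by (intro alg_comp_mult subspace_scale[OF subspace_alg_comp] yi wk)
    then have "scale (1 / c) (y i) * w k \<in> alg_comp (q - b k)" using yi wk by simp
    moreover have "y k \<in> alg_comp (q - b k)" using y wk yi by (simp add: vec_comp_def)
    ultimately show ?thesis
      using wk yi subspace_diff[OF subspace_alg_comp] by (simp add: eliminate_def)
  qed
  then show ?thesis
    using eliminate_at[of c w i y] c unfolding vec_comp_def by auto
qed

text \<open>Elimination is a linear projection of the span onto its part with vanishing
  \<open>i\<close>-th coefficient, so the images of the generators generate that part; discarding
  \<open>0\<close> does not change their span.\<close>

lemma left_span_eliminate:
  assumes c: "c \<noteq> 0" "w i = scale c 1" and w: "w \<in> S"
  shows "left_span (eliminate scale c i w ` S - {0}) = left_span S \<inter> {y. y i = 0}"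
    (is "left_span ?T = _")
proof
  let ?e = "eliminate scale c i w"
  note S = left_submoduleD[OF left_submodule_left_span[of S]]
  note T = left_submoduleD[OF left_submodule_left_span[of ?T]]
  have "left_submodule (left_span S \<inter> {y. y i = 0})"
    by (intro left_submodule_Int left_submodule_left_span) (auto simp: left_submodule_def)
  moreover have "?e y \<in> left_span S" if "y \<in> S" for y
  proof -
    have "y \<in> left_span S" "w \<in> left_span S" using that w left_span_superset by blast+
    then have "y - (\<lambda>k. scale (1 / c) (y i) * w k) \<in> left_span S" using S(3,5) by blast
    then show ?thesis by (simp add: diff_eliminate[symmetric])
  qed
  ultimately show "left_span ?T \<subseteq> left_span S \<inter> {y. y i = 0}"
    using eliminate_at[of c w i] c by (intro left_span_minimal) auto
  \<comment> \<open>For the other inclusion, linearity extends membership of the images from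
    \<open>S\<close> to its span.\<close>
  have "left_submodule {y. ?e y \<in> left_span ?T}"
  proof -
    have "?e 0 = 0" "?e (x + y) = ?e x + ?e y" "?e (\<lambda>k. r * x k) = (\<lambda>k. r * ?e x k)" for x y r
      by (auto simp: eliminate_def scale_mult_left scale_mult_right scale_right_distrib algebra_simps
          scale_right_diff_distrib)
    then show ?thesis using T(1-3) by (simp add: left_submodule_def)
  qed
  moreover have "S \<subseteq> {y. ?e y \<in> left_span ?T}"
    using T(1) left_span_superset[of ?T] by auto
  ultimately have "left_span S \<subseteq> {y. ?e y \<in> left_span ?T}" by (rule left_span_minimal)
  \<comment> \<open>Vectors with vanishing \<open>i\<close>-th coefficient are their own
    images.\<close>
  moreover have "?e y = y" if "y i = 0" for y using that by (simp add: eliminate_def)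
  ultimately show "left_span S \<inter> {y. y i = 0} \<subseteq> left_span ?T" by force
qed

section \<open>Invariance and terminal states of the loop\<close>

text \<open>The loop invariant: the relations \<open>V\<close> on the basis vectors \<open>E\<close> present the graded module
  \<open>L\<^sub>0 / N\<close>, where \<open>I\<close> is the initial index set.\<close>

definition presents ::
    "(nat \<Rightarrow> nat) \<Rightarrow> nat set \<Rightarrow> (nat \<Rightarrow> 'a) set \<Rightarrow> (nat \<Rightarrow> 'a) list \<times> nat list \<Rightarrow> bool" where
  "presents b I N st \<longleftrightarrow> (case st of (V, E) \<Rightarrow>
     distinct E \<and> set E \<subseteq> I \<and>
     (\<forall>v\<in>set V. \<exists>q. v \<in> vec_comp b (set E) q) \<and>
     left_span (set V) = N \<inter> supported (set E) \<and>
     (\<forall>x\<in>supported I. \<exists>y\<in>supported (set E). x - y \<in> N) \<and>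
     (\<forall>q. \<forall>x\<in>vec_comp b I q. \<exists>y\<in>vec_comp b (set E) q. x - y \<in> N))"

text \<open>The invariant sees the lists only as sets; distinctness of \<open>E\<close> makes
  deletion at a position the removal of an element.\<close>

lemma min_stepE:
  assumes "min_step scale (V, E) (W, F)" "distinct E"
  obtains c i w where "c \<noteq> 0" "i \<in> set E" "w \<in> set V" "w i = scale c 1"
    "set W = eliminate scale c i w ` set V - {0}" "distinct F" "set F = set E - {i}"
  using assms(1)
proof cases
  case (1 j p c V')
  let ?i = "E ! p" and ?w = "V ! j"
  \<comment> \<open>The pivot position \<open>j\<close> is split off; its image is \<open>0\<close>,
    so adding it changes nothing once zero vectors are filtered out.\<close>
  have idx: "{..<length V} = insert j (set ([0..<j] @ [Suc j..<length V]))"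
    using 1 by auto
  have "set V = (!) V ` {..<length V}" by (auto simp: set_conv_nth)
  then have "eliminate scale c ?i ?w ` set V =
      insert (eliminate scale c ?i ?w ?w) (set V')"
    unfolding idx 1 by (simp add: image_image image_Un eliminate_def)
  moreover have "eliminate scale c ?i ?w ?w = 0" using 1 by (intro eliminate_self[of c ?w ?i])
  ultimately have W: "set W = eliminate scale c ?i ?w ` set V - {0}"
    using 1 by auto
  have "E = take p E @ ?i # drop (Suc p) E" using 1 by (simp add: id_take_nth_drop)
  then have "distinct (take p E @ ?i # drop (Suc p) E)"
    "set E = set (take p E @ ?i # drop (Suc p) E)" using assms(2) by metis+
  then have "distinct F" "set F = set E - {?i}" using 1 by auto
  then show thesis using that[of c ?i ?w] 1 W by simp
qed

text \<open>The decomposition clauses are carried over by eliminating in the old witness, which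
  moves it only by a left multiple of \<open>w \<in> N\<close>; the span clause is
  \<open>left_span_eliminate\<close>.\<close>

lemma presents_step:
  assumes pres: "presents b I N st" and step: "min_step scale st st'" and N: "left_submodule N"
  shows "presents b I N st'"
proof -
  obtain V E W F where st: "st = (V, E)" "st' = (W, F)" by (cases st, cases st')
  have E: "distinct E" "set E \<subseteq> I"
    and V: "\<And>v. v \<in> set V \<Longrightarrow> \<exists>q. v \<in> vec_comp b (set E) q"
    and span: "left_span (set V) = N \<inter> supported (set E)"
    and decomp: "\<And>x. x \<in> supported I \<Longrightarrow> \<exists>y\<in>supported (set E). x - y \<in> N"
    and comp_decomp: "\<And>q x. x \<in> vec_comp b I q \<Longrightarrow> \<exists>y\<in>vec_comp b (set E) q. x - y \<in> N"
    using pres unfolding st presents_def by auto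
  obtain c i w where c: "c \<noteq> 0" "w i = scale c 1" and i: "i \<in> set E" and w: "w \<in> set V"
    and W: "set W = eliminate scale c i w ` set V - {0}"
    and F: "distinct F" "set F = set E - {i}"
    using min_stepE[OF step[unfolded st] E(1)] by metis
  obtain p where wp: "w \<in> vec_comp b (set E) p" using V[OF w] by blast
  then have ws: "w \<in> supported (set E)" using vec_comp_subset_supported by blast
  have "w \<in> N" using w span left_span_superset by blast
  \<comment> \<open>Elimination does not leave the coset modulo \<open>N\<close>.\<close>
  then have diff: "x - eliminate scale c i w y \<in> N" if "x - y \<in> N" for x y
  proof -
    have "(x - y) + (y - eliminate scale c i w y) \<in> N"
      unfolding diff_eliminate using left_submoduleD(2,3)[OF N] that \<open>w \<in> N\<close> by blast
    then show ?thesis by simp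
  qed
  have "\<exists>q. v \<in> vec_comp b (set F) q" if v: "v \<in> set W" for v
  proof -
    obtain y where y: "y \<in> set V" "v = eliminate scale c i w y"
      using v unfolding W by blast
    moreover obtain q where "y \<in> vec_comp b (set E) q" using V y by blast
    ultimately show ?thesis
      unfolding F y(2) using eliminate_vec_comp[of c w i, OF c wp] by blast
  qed
  \<comment> \<open>Support in \<open>set E\<close> together with coefficient \<open>0\<close> at
    \<open>i\<close> means support in \<open>set F\<close>.\<close>
  moreover have "left_span (set W) = N \<inter> supported (set F)"
    unfolding W left_span_eliminate[of c w i, OF c w] span F(2) by (auto simp: supported_def)
  moreover have "\<exists>y\<in>supported (set F). x - y \<in> N" if x: "x \<in> supported I" for x
  proof -
    obtain y where y: "y \<in> supported (set E)" "x - y \<in> N" using decomp[OF x] by blast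
    show ?thesis
      unfolding F(2)
      using diff[OF y(2)] eliminate_supported[of c w i, OF c ws y(1)] by (rule bexI)
  qed
  moreover have "\<exists>y\<in>vec_comp b (set F) q. x - y \<in> N" if x: "x \<in> vec_comp b I q" for x q
  proof -
    obtain y where y: "y \<in> vec_comp b (set E) q" "x - y \<in> N" using comp_decomp[OF x] by blast
    show ?thesis
      unfolding F(2)
      using diff[OF y(2)] eliminate_vec_comp[of c w i, OF c wp y(1)] by (rule bexI)
  qed
  ultimately show ?thesis
    using F E unfolding st presents_def by auto
qed

text \<open>The rule asks for the first position with a nonzero scalar coefficient; taking the least
  one turns any such coefficient into a possible step.\<close>

lemma irreducible_coeff_nonscalar:
  assumes stuck: "\<nexists>st'. min_step scale (V, E) st'" and "v \<in> set V" "i \<in> set E"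
  shows "v i \<notin> nonzero_scalars scale"
proof
  assume scalar: "v i \<in> nonzero_scalars scale"
  obtain j where j: "j < length V" "v = V ! j" using assms(2) by (auto simp: in_set_conv_nth)
  let ?P = "\<lambda>p. p < length E \<and> v (E ! p) \<in> nonzero_scalars scale"
  define p where "p = (LEAST p. ?P p)"
  have "\<exists>p. ?P p" using scalar assms(3) by (auto simp: in_set_conv_nth)
  then have p: "?P p" unfolding p_def by (rule LeastI_ex)
  have "v (E ! q) \<notin> nonzero_scalars scale" if "q < p" for q
    using not_less_Least[of q ?P] that p unfolding p_def by auto
  moreover obtain c where "c \<noteq> 0" "v (E ! p) = scale c 1"
    using p by (auto simp: nonzero_scalars_def)
  ultimately show False
    using stuck min_step.intros[of j V p E scale c, OF j(1) _ _ _ _ refl] p j(2) by blast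
qed

end

section \<open>Termination\<close>

lemma min_step_length: "min_step scale (V, E) (W, F) \<Longrightarrow> length F < length E"
  by (auto elim!: min_step.cases)

text \<open>The number of remaining basis vectors drops whatever pivots are chosen;
  \<open>termip\<close> is accessibility for the converse relation.\<close>

lemma termip_min_step: "termip (min_step scale) st"
proof -
  have "wfp (\<lambda>st' st :: (nat \<Rightarrow> 'a) list \<times> nat list. length (snd st') < length (snd st))"
    by (intro wfp_if_convertible_to_nat[of _ "\<lambda>st. length (snd st)"]) simp
  then have "wfp ((min_step scale)\<inverse>\<inverse>)"
    by (rule wfp_subset) (use min_step_length in fastforce)
  then show ?thesis unfolding wfp_iff_accp by blast
qed

section \<open>The presentation returned by the algorithm and its minimality\<close>

theorem proposition4p2:
  fixes scale :: "'k::field \<Rightarrow> 'a::ring_1 \<Rightarrow> 'a"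
    and n s :: nat and a :: "nat \<Rightarrow> 'a" and prec :: "'a \<Rightarrow> 'a \<Rightarrow> bool"
    and d b :: "nat \<Rightarrow> nat" and \<xi> :: "(nat \<Rightarrow> 'a) list"
    and L\<^sub>0 :: "('a, nat \<Rightarrow> 'a) graded_module" and N :: "(nat \<Rightarrow> 'a) set"
    and M :: "('a, (nat \<Rightarrow> 'a) set) graded_module"
  assumes "solvable_polynomial_algebra scale n a prec"
    and "weighted_graded scale n a d"
    and "L\<^sub>0 = free_module scale n a d b {..<s}"
    and "\<forall>x\<in>set \<xi>. x \<in> carrier L\<^sub>0 \<and> x \<noteq> 0 \<and> homogeneous L\<^sub>0 x"
    and "N = generated_submodule L\<^sub>0 (set \<xi>)"
    and "M = quotient_module L\<^sub>0 N"
  shows "termip (min_step scale) (\<xi>, [0..<s]) \<and>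
    (\<forall>V E'. min_output scale s \<xi> (V, E') \<longrightarrow>
      (let L\<^sub>0' = free_module scale n a d b (set E');
           N' = generated_submodule L\<^sub>0' (set V)
       in distinct E' \<and> set E' \<subseteq> {..<s} \<and> length E' \<le> s \<and>
          set V \<subseteq> N \<inter> carrier L\<^sub>0' \<and>
          (\<forall>v\<in>set V. \<forall>i\<in>set E'. v i \<noteq> 0 \<longrightarrow> v i \<notin> nonzero_scalars scale) \<and>
          graded_submodule L\<^sub>0' N' \<and>
          graded_isomorphic M (quotient_module L\<^sub>0' N') \<and>
          inj_on (\<lambda>i. coset L\<^sub>0 N (unit_vec i)) (set E') \<and>
          minimal_homogeneous_generating_set M ((\<lambda>i. coset L\<^sub>0 N (unit_vec i)) ` set E')))"
proof -
  have "assoc_algebra scale" and basis: "has_monomial_basis scale n a"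
    using assms(1) by (auto simp: solvable_polynomial_algebra_def)
  then interpret assoc_algebra scale by simp
  interpret weighted_graded_algebra scale n a d
    by unfold_locales (use basis assms(2) in auto)
  note L\<^sub>0 = assms(3)
  have \<xi>: "set \<xi> \<subseteq> supported {..<s}" "\<And>x. x \<in> set \<xi> \<Longrightarrow> \<exists>q. x \<in> vec_comp b {..<s} q"
    using assms(4) by (auto simp: L\<^sub>0 free_module_simps homogeneous_def component_free_module)
  have N: "N = left_span (set \<xi>)"
    unfolding assms(5) L\<^sub>0 by (rule generated_submodule_free_module[OF \<xi>(1)])
  then have N_sub: "left_submodule N" by (simp add: left_submodule_left_span)
  have N_supp: "N \<subseteq> supported {..<s}"
    unfolding N using left_submodule_supported \<xi>(1) by (rule left_span_minimal)
  have self: "x - x \<in> N" for x using left_submoduleD(1)[OF N_sub] by simp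
  \<comment> \<open>Before the first round every vector is its own representative.\<close>
  have init: "presents b {..<s} N (\<xi>, [0..<s])"
  proof -
    have "set [0..<s] = {..<s}" by auto
    then show ?thesis
      using \<xi>(2) self N N_supp unfolding presents_def by auto
  qed
  have inv: "presents b {..<s} N st" if "(min_step scale)\<^sup>*\<^sup>* (\<xi>, [0..<s]) st" for st
    using that by (induction rule: rtranclp_induct) (auto intro: init presents_step[OF _ _ N_sub])
  show ?thesis
  proof (intro conjI allI impI)
    show "termip (min_step scale) (\<xi>, [0..<s])" by (rule termip_min_step)
  next
    fix V E' assume out: "min_output scale s \<xi> (V, E')"
    define J where "J = set E'"
    have "presents b {..<s} N (V, E')" using inv out by (simp add: min_output_def)
    then have E': "distinct E'" "J \<subseteq> {..<s}"
      and V: "\<And>v. v \<in> set V \<Longrightarrow> \<exists>q. v \<in> vec_comp b J q"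
      and span: "left_span (set V) = N \<inter> supported J"
      and decomp: "\<And>x. x \<in> supported {..<s} \<Longrightarrow> \<exists>y\<in>supported J. x - y \<in> N"
      and comp_decomp: "\<And>q x. x \<in> vec_comp b {..<s} q \<Longrightarrow> \<exists>y\<in>vec_comp b J q. x - y \<in> N"
      unfolding presents_def J_def by auto
    have fin: "finite J" by (simp add: J_def)
    have nonscalar: "v i \<notin> nonzero_scalars scale" if "v \<in> set V" "i \<in> J" for v i
      using irreducible_coeff_nonscalar[of V E'] out that by (auto simp: min_output_def J_def)
    have V_supp: "set V \<subseteq> supported J" using V vec_comp_subset_supported by blast
    have V_N: "set V \<subseteq> N \<inter> supported J" using span left_span_superset by blast
    let ?L = "free_module scale n a d b"
    have N': "generated_submodule (?L J) (set V) = N \<inter> supported J"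
      using generated_submodule_free_module[OF V_supp] span by simp
    \<comment> \<open>A coefficient of a vector in \<open>V\<close> is homogeneous and no nonzero
      scalar, hence positive; the left ideal property extends this to all of
      \<open>N \<inter> supported J\<close>.\<close>
    have positive: "x i \<in> positive_part" if "x \<in> N" "x \<in> supported J" "i \<in> J" for x i
    proof -
      have "set V \<subseteq> {x. x i \<in> positive_part}"
        using V nonscalar \<open>i \<in> J\<close> vec_comp_coeff_positive by blast
      then have "left_span (set V) \<subseteq> {x. x i \<in> positive_part}"
        using left_submodule_coeff_positive by (intro left_span_minimal)
      then show ?thesis using span that by blast
    qed
    have iso: "graded_isomorphic M (quotient_module (?L J) (N \<inter> supported J))"
      unfolding assms(6) L\<^sub>0
    proof (rule graded_isomorphic_quotient_Int[OF N_sub E'(2)])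
      show "component (?L J) q \<subseteq> component (?L {..<s}) q" for q
        using vec_comp_mono[OF E'(2)] by (simp add: component_free_module fin)
    qed (use decomp comp_decomp vec_comp_subset_supported in
        \<open>auto simp: component_free_module fin\<close>)
    have unit_supp: "unit_vec i \<in> supported J" if "i \<in> J" for i
      using that by (auto simp: supported_def unit_vec_def)
    have JI: "supported J \<subseteq> (supported {..<s} :: (nat \<Rightarrow> 'a) set)"
      using E'(2) by (auto simp: supported_def)
    \<comment> \<open>If two cosets agreed, \<open>unit_vec i - unit_vec k\<close> would lie in
      \<open>N\<close> with coefficient \<open>1\<close> at \<open>i\<close>.\<close>
    have inj: "inj_on (\<lambda>i. (+) (unit_vec i) ` N) J"
    proof (rule inj_onI, rule ccontr)
      fix i k assume ik: "i \<in> J" "k \<in> J" "(+) (unit_vec i) ` N = (+) (unit_vec k) ` N" "i \<noteq> k"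
      then have "unit_vec i - unit_vec k \<in> N" by (simp add: coset_eq_iff[OF N_sub])
      moreover have "unit_vec i - unit_vec k \<in> (supported J :: (nat \<Rightarrow> 'a) set)"
        using left_submoduleD(5)[OF left_submodule_supported] unit_supp ik by blast
      ultimately have "(unit_vec i - unit_vec k) i \<in> positive_part"
        using positive ik by blast
      then show False using one_notin_positive_part ik by (simp add: unit_vec_def)
    qed
    have coset: "coset L\<^sub>0 N x = (+) x ` N" for x by (simp add: L\<^sub>0 coset_free_module)
    note M = quotient_free_module_simps[OF N_sub, of scale n a d b "{..<s}",
        folded L\<^sub>0, folded assms(6)]
    note generates = generated_quotient_eq_carrier_iff[OF N_sub N_supp, of _ scale n a d b,
        folded L\<^sub>0, folded assms(6)]
    have min: "minimal_homogeneous_generating_set M ((\<lambda>i. (+) (unit_vec i) ` N) ` J)"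
      unfolding minimal_homogeneous_generating_set_def
    proof (intro conjI allI impI)
      show "(\<lambda>i. (+) (unit_vec i) ` N) ` J \<subseteq> carrier M"
        unfolding M using unit_supp JI by blast
      show "\<forall>X\<in>(\<lambda>i. (+) (unit_vec i) ` N) ` J. homogeneous M X"
      proof (intro ballI)
        fix X assume "X \<in> (\<lambda>i. (+) (unit_vec i) ` N) ` J"
        then obtain i where i: "i \<in> J" "X = (+) (unit_vec i) ` N" by blast
        then have "unit_vec i \<in> component L\<^sub>0 (b i)"
          using unit_vec_in_vec_comp E'(2) by (auto simp: L\<^sub>0 component_free_module)
        then show "homogeneous M X" unfolding homogeneous_def M using i by blast
      qed
      \<comment> \<open>Modulo \<open>N\<close> every vector is supported on \<open>J\<close>, hence
        a combination of the \<open>unit_vec i\<close> with \<open>i \<in> J\<close>.\<close>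
      have "supported {..<s} \<subseteq> left_span (unit_vec ` J \<union> N)"
      proof
        fix x :: "nat \<Rightarrow> 'a" assume "x \<in> supported {..<s}"
        then obtain y where y: "y \<in> supported J" "x - y \<in> N" using decomp by blast
        have "y \<in> left_span (unit_vec ` J \<union> N)"
          using supported_subset_left_span_unit_vec[OF fin] y(1)
            left_span_mono[of "unit_vec ` J" "unit_vec ` J \<union> N"] by blast
        moreover have "x - y \<in> left_span (unit_vec ` J \<union> N)"
          using y(2) left_span_superset[of "unit_vec ` J \<union> N"] by blast
        ultimately have "(x - y) + y \<in> left_span (unit_vec ` J \<union> N)"
          by (intro left_submoduleD(2)[OF left_submodule_left_span])
        then show "x \<in> left_span (unit_vec ` J \<union> N)" by simp
      qed
      then show "generated_submodule M ((\<lambda>i. (+) (unit_vec i) ` N) ` J) = carrier M"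
        using generates[of "unit_vec ` J"] unit_supp JI by (auto simp: image_image)
    next
      fix G' assume G': "G' \<subset> (\<lambda>i. (+) (unit_vec i) ` N) ` J"
      then obtain i where i: "i \<in> J" "(+) (unit_vec i) ` N \<notin> G'" by blast
      \<comment> \<open>\<open>K\<close> collects the indices whose cosets remain; it misses
        \<open>i\<close> because \<open>G'\<close> omits the coset of
        \<open>unit_vec i\<close>.\<close>
      define K where "K = {k\<in>J. (+) (unit_vec k) ` N \<in> G'}"
      have K: "K \<subseteq> J - {i}" using i(2) by (auto simp: K_def)
      have G'_eq: "G' = (\<lambda>x. (+) x ` N) ` unit_vec ` K" using G' by (auto simp: K_def)
      show "generated_submodule M G' \<noteq> carrier M"
      proof
        assume "generated_submodule M G' = carrier M"
        then have "supported {..<s} \<subseteq> left_span (unit_vec ` K \<union> N)"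
          using generates[of "unit_vec ` K"] unit_supp JI K unfolding G'_eq by blast
        moreover have "unit_vec i \<in> (supported {..<s} :: (nat \<Rightarrow> 'a) set)"
          using unit_supp i JI by blast
        ultimately have mem: "unit_vec i \<in> left_span (unit_vec ` K \<union> N)" by blast
        \<comment> \<open>\<open>x\<close> involves only unit vectors from \<open>K\<close>, so
          \<open>unit_vec i - x\<close> lies in \<open>N\<close> and keeps the coefficient
          \<open>1\<close> at \<open>i\<close>.\<close>
        obtain x where x: "x \<in> left_span (unit_vec ` K)" "unit_vec i - x \<in> N"
          using left_span_Un_submodule[OF N_sub mem] by blast
        have "unit_vec ` K \<subseteq> (supported (J - {i}) :: (nat \<Rightarrow> 'a) set)"
          using K by (auto simp: supported_def unit_vec_def)
        then have "x \<in> supported (J - {i})"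
          using x(1) left_span_minimal[OF left_submodule_supported[of "J - {i}"]] by blast
        then have xs: "x \<in> supported J" "x i = 0" by (auto simp: supported_def)
        have "(unit_vec i - x) i \<in> positive_part"
          by (rule positive[OF x(2) left_submoduleD(5)[OF left_submodule_supported
                unit_supp[OF i(1)] xs(1)] i(1)])
        then show False using one_notin_positive_part xs(2) by (simp add: unit_vec_def)
      qed
    qed
    have "length E' \<le> s"
      using E' card_mono[OF _ E'(2)] distinct_card[of E'] by (simp add: J_def)
    \<comment> \<open>By the invariant the vectors of \<open>V\<close> are homogeneous
      generators.\<close>
    moreover have "graded_submodule (?L J) (N \<inter> supported J)"
      unfolding graded_submodule_def
      using V V_supp N'
      by (intro exI[of _ "set V"])
        (auto simp: free_module_simps homogeneous_def component_free_module fin)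
    ultimately show "let L\<^sub>0' = ?L (set E'); N' = generated_submodule L\<^sub>0' (set V)
       in distinct E' \<and> set E' \<subseteq> {..<s} \<and> length E' \<le> s \<and>
          set V \<subseteq> N \<inter> carrier L\<^sub>0' \<and>
          (\<forall>v\<in>set V. \<forall>i\<in>set E'. v i \<noteq> 0 \<longrightarrow> v i \<notin> nonzero_scalars scale) \<and>
          graded_submodule L\<^sub>0' N' \<and>
          graded_isomorphic M (quotient_module L\<^sub>0' N') \<and>
          inj_on (\<lambda>i. coset L\<^sub>0 N (unit_vec i)) (set E') \<and>
          minimal_homogeneous_generating_set M ((\<lambda>i. coset L\<^sub>0 N (unit_vec i)) ` set E')"
      using E' V_N nonscalar iso inj min
      unfolding J_def[symmetric] Let_def coset N' free_module_simps by blast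
  qed
qed

end
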